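(* Let $N$ be a positive integer. Suppose the sequences $\{\alpha_n\}$ and $\{\beta_n\}$ are related by $\beta_n=\sum_{r=0}^{n}\alpha_r$. Then $$\sum_{n=0}^{N}\frac{(q\sqrt{k},-q\sqrt{k},y,z,k^2q^{N}/(yz),q^{-N};q)_n}{(\sqrt{k},-\sqrt{k},qk/y,qk/z,yzq^{1-N}/k,kq^{1+N};q)_n}\,q^n\,\beta_n$$ $$=\frac{(1-k/y)(1-k/z)(1-kq^N)(1-kq^N/(yz))}{(1-k)(1-k/(yz))(1-kq^N/y)(1-kq^N/z)}\sum_{n=0}^{N}\frac{(y,z,k^2q^{N}/(yz),q^{-N};q)_{n}}{(k/y,k/z,kq^{N},yzq^{-N}/k;q)_{n}}\,\alpha_n.$$
   Context: For an integer $n\ge 0$, $(x;q)_n=\prod_{i=0}^{n-1}(1-xq^i)$ and $(x_1,\dots,x_m;q)_n=\prod_{j=1}^m(x_j;q)_n$. Here $q,k,y,z$ are nonzero complex numbers such that none of the denominators vanish, $\sqrt k$ is a fixed square root of $k$, and $\{\alpha_n\}_{n\ge0},\{\beta_n\}_{n\ge0}$ are sequences of complex numbers. *)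

theory Defs
  imports Complex_Main
begin

definition qpoch :: "complex \<Rightarrow> complex \<Rightarrow> nat \<Rightarrow> complex" where
  "qpoch x q n = (\<Prod>i<n. 1 - x * q ^ i)"

definition qpochs :: "complex list \<Rightarrow> complex \<Rightarrow> nat \<Rightarrow> complex" where
  "qpochs xs q n = (\<Prod>x\<leftarrow>xs. qpoch x q n)"

end

theory Submission
  imports Defs
begin

text \<open>
  Put \<open>w = k\<^sup>2 q\<^sup>N / (y z)\<close> and \<open>v = q\<^sup>-\<^sup>N\<close>. The lower parameters on the right are \<open>k/y, k/z, k/w, k/v\<close>
  and \<open>y z w v = k\<^sup>2\<close>, so both sides are symmetric in \<open>y, z, w, v\<close>. This balancing condition makes
  the coefficient of \<open>\<beta>\<^sub>n\<close> on the left a constant multiple of the difference of two consecutive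
  coefficients on the right; the theorem is then summation by parts, where the boundary term
  vanishes because \<open>(q\<^sup>-\<^sup>N;q)\<close> has a zero factor from index \<open>N + 1\<close> on.
\<close>

lemma qpochs_Nil [simp]: "qpochs [] q n = 1"
  by (simp add: qpochs_def)

lemma qpochs_Cons [simp]: "qpochs (x # xs) q n = qpoch x q n * qpochs xs q n"
  by (simp add: qpochs_def)

lemma qpoch_Suc: "qpoch x q (Suc n) = qpoch x q n * (1 - x * q ^ n)"
  by (simp add: qpoch_def)

lemma qpoch_Suc_shift: "qpoch x q (Suc n) = (1 - x) * qpoch (q * x) q n"
  unfolding qpoch_def prod.lessThan_Suc_shift by (simp add: algebra_simps)

lemma qpoch_power_int_eq_0:
  assumes "q \<noteq> 0" and "N < n"
  shows "qpoch (q powi (- int N)) q n = 0"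
proof -
  have "q powi (- int N) * q ^ N = 1"
    using assms(1) by (simp add: power_int_minus)
  then show ?thesis
    unfolding qpoch_def using assms(2) by (intro prod_zero) (auto intro!: bexI[of _ N])
qed

text \<open>Multiplying the base by \<open>q\<close> replaces the first factor of the product by the
  next one, so the ratio for \<open>s\<close> telescopes to
  \<open>(1 - s * q ^ n) / (1 - s)\<close>. Pairing \<open>s\<close> with \<open>- s\<close> leaves
  differences of squares, hence only \<open>k\<close>.\<close>

lemma well_poised_ratio:
  assumes "s ^ 2 = k" and "qpoch s q n \<noteq> 0" and "qpoch (- s) q n \<noteq> 0" and "k \<noteq> 1"
  shows "qpoch (q * s) q n * qpoch (- (q * s)) q n / (qpoch s q n * qpoch (- s) q n)
         = (1 - k * (q ^ n)\<^sup>2) / (1 - k)"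
proof -
  have "(1 - s) * qpoch (q * s) q n = qpoch s q n * (1 - s * q ^ n)"
    using qpoch_Suc[of s q n] qpoch_Suc_shift[of s q n] by simp
  moreover have "(1 + s) * qpoch (- (q * s)) q n = qpoch (- s) q n * (1 + s * q ^ n)"
    using qpoch_Suc[of "- s" q n] qpoch_Suc_shift[of "- s" q n] by simp
  ultimately have "((1 - s) * qpoch (q * s) q n) * ((1 + s) * qpoch (- (q * s)) q n)
      = (qpoch s q n * (1 - s * q ^ n)) * (qpoch (- s) q n * (1 + s * q ^ n))"
    by simp
  moreover have "1 - k = (1 - s) * (1 + s)"
    and "1 - k * (q ^ n)\<^sup>2 = (1 - s * q ^ n) * (1 + s * q ^ n)"
    unfolding assms(1)[symmetric] by algebra+
  ultimately have "(1 - k) * (qpoch (q * s) q n * qpoch (- (q * s)) q n)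
      = (1 - k * (q ^ n)\<^sup>2) * (qpoch s q n * qpoch (- s) q n)"
    by (simp add: mult_ac)
  then show ?thesis
    using assms by (simp add: frac_eq_eq mult_ac)
qed

text \<open>Both products are quartics in \<open>t\<close> with constant term 1. Since
  \<open>a * b * c * d = k\<^sup>2\<close>, their coefficients of \<open>t^2\<close> and
  \<open>t^4\<close> agree as well, and the differences at \<open>t\<close> and \<open>t^3\<close>
  are in ratio \<open>1 : -k\<close>. What remains is \<open>t * (1 - k * t\<^sup>2)\<close> times
  \<open>e1 - e3 / k\<close>, with \<open>e1\<close>, \<open>e3\<close> the elementary symmetric
  functions of \<open>a, b, c, d\<close>; under the balancing condition this factors as
  stated.\<close>

lemma balanced_product_diff:
  fixes a b c d k t :: "'a::field"
  assumes "k \<noteq> 0" and "a * b * c * d = k\<^sup>2"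
  shows "(1 - k / a * t) * (1 - k / b * t) * (1 - k / c * t) * (1 - k / d * t)
         - (1 - a * t) * (1 - b * t) * (1 - c * t) * (1 - d * t)
         = d * (1 - k / (a * d)) * (1 - k / (b * d)) * (1 - k / (c * d)) * t * (1 - k * t\<^sup>2)"
proof -
  have nz: "a \<noteq> 0" "b \<noteq> 0" "c \<noteq> 0"
    using assms by auto
  then have d: "d = k\<^sup>2 / (a * b * c)"
    using assms(2) by (simp add: eq_divide_eq mult_ac)
  show ?thesis
    unfolding d using nz assms(1)
    by (simp add: divide_simps) algebra
qed

lemma coefficient_diff:
  assumes "k \<noteq> 0" and "a * b * c * d = k\<^sup>2"
    and nz: "qpochs [k / a, k / b, k / c, k / d] q (Suc n) \<noteq> 0"
  shows "qpochs [a, b, c, d] q n / qpochs [k / a, k / b, k / c, k / d] q n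
         - qpochs [a, b, c, d] q (Suc n) / qpochs [k / a, k / b, k / c, k / d] q (Suc n)
         = d * (1 - k / (a * d)) * (1 - k / (b * d)) * (1 - k / (c * d))
           / ((1 - k / a) * (1 - k / b) * (1 - k / c) * (1 - k / d))
           * ((1 - k * (q ^ n)\<^sup>2) * qpochs [a, b, c, d] q n
              / qpochs [q * (k / a), q * (k / b), q * (k / c), q * (k / d)] q n * q ^ n)"
    (is "?u n - ?u (Suc n) = ?E / ?F * (?K * ?P / ?D' * ?t)")
proof -
  let ?P' = "(1 - a * ?t) * (1 - b * ?t) * (1 - c * ?t) * (1 - d * ?t)"
  let ?G = "(1 - k / a * ?t) * (1 - k / b * ?t) * (1 - k / c * ?t) * (1 - k / d * ?t)"
  let ?D = "qpochs [k / a, k / b, k / c, k / d] q"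
  have D: "?D (Suc n) = ?D n * ?G" and P: "qpochs [a, b, c, d] q (Suc n) = ?P * ?P'"
    by (simp_all add: qpoch_Suc mult_ac)
  \<comment> \<open>The denominator at \<open>Suc n\<close> is split in two ways: taking off the
    last factors gives a common denominator with \<open>?u n\<close>, taking off the first ones
    gives the parameters shifted by \<open>q\<close>.\<close>
  have D': "?D (Suc n) = ?F * ?D'"
    by (simp add: qpoch_Suc_shift mult_ac)
  have "?D n \<noteq> 0" "?G \<noteq> 0"
    using nz unfolding D by (auto simp del: qpochs_Cons)
  then have "?u n = ?P * ?G / ?D (Suc n)"
    unfolding D by (simp del: qpochs_Cons)
  then have "?u n - ?u (Suc n) = ?P * (?G - ?P') / ?D (Suc n)"
    unfolding P by (simp only: diff_divide_distrib right_diff_distrib)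
  also have "?G - ?P' = ?E * ?t * ?K"
    by (rule balanced_product_diff[OF assms(1,2)])
  also have "?P * (?E * ?t * ?K) / ?D (Suc n) = ?E / ?F * (?K * ?P / ?D' * ?t)"
    unfolding D' times_divide_times_eq times_divide_eq_left times_divide_eq_right
    by (simp only: divide_divide_eq_left mult_ac)
  finally show ?thesis .
qed

lemma sum_by_parts:
  fixes u \<alpha> :: "nat \<Rightarrow> 'a::comm_ring"
  shows "(\<Sum>n\<le>N. (u n - u (Suc n)) * (\<Sum>r\<le>n. \<alpha> r))
         = (\<Sum>n\<le>N. u n * \<alpha> n) - u (Suc N) * (\<Sum>r\<le>N. \<alpha> r)"
  by (induction N) (simp_all add: algebra_simps)

theorem corollary2:
  fixes q k sqrtk y z :: complex
    and \<alpha> \<beta> :: "nat \<Rightarrow> complex"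
    and N :: nat
  assumes "N > 0"
    and "q \<noteq> 0" and "k \<noteq> 0" and "y \<noteq> 0" and "z \<noteq> 0"
    and "sqrtk ^ 2 = k"
    and "\<And>n. \<beta> n = (\<Sum>r\<le>n. \<alpha> r)"
    and "\<And>n. n \<le> N \<Longrightarrow>
          qpochs [sqrtk, - sqrtk, q * k / y, q * k / z,
                  y * z * q powi (1 - int N) / k, k * q ^ (1 + N)] q n \<noteq> 0"
    and "\<And>n. n \<le> N \<Longrightarrow>
          qpochs [k / y, k / z, k * q ^ N, y * z * q powi (- int N) / k] q n \<noteq> 0"
    and "(1 - k) * (1 - k / (y * z)) * (1 - k * q ^ N / y) * (1 - k * q ^ N / z) \<noteq> 0"
  shows "(\<Sum>n\<le>N.
            qpochs [q * sqrtk, - q * sqrtk, y, z, k ^ 2 * q ^ N / (y * z), q powi (- int N)] q n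
          / qpochs [sqrtk, - sqrtk, q * k / y, q * k / z,
                    y * z * q powi (1 - int N) / k, k * q ^ (1 + N)] q n
          * q ^ n * \<beta> n)
       = (1 - k / y) * (1 - k / z) * (1 - k * q ^ N) * (1 - k * q ^ N / (y * z))
         / ((1 - k) * (1 - k / (y * z)) * (1 - k * q ^ N / y) * (1 - k * q ^ N / z))
         * (\<Sum>n\<le>N.
              qpochs [y, z, k ^ 2 * q ^ N / (y * z), q powi (- int N)] q n
            / qpochs [k / y, k / z, k * q ^ N, y * z * q powi (- int N) / k] q n
            * \<alpha> n)"
proof -
  define v where "v = q powi (- int N)"
  define w where "w = k ^ 2 * q ^ N / (y * z)"
  note nz = assms(2-5)
  have vQ: "v * q ^ N = 1"
    using nz by (simp add: v_def power_int_minus)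
  then have v0: "v \<noteq> 0" and Qv: "q ^ N = 1 / v"
    by (auto simp: eq_divide_eq mult_ac)
  have w: "w = k\<^sup>2 / (v * y * z)"
    unfolding w_def Qv by simp
  have w0: "w \<noteq> 0"
    using nz v0 by (simp add: w)
  have balanced: "y * z * w * v = k\<^sup>2"
    using nz v0 by (simp add: w)
  have qv: "q powi (1 - int N) = q * v"
    using nz by (simp add: v_def power_int_diff power_int_minus field_simps)
  \<comment> \<open>This identifies the last two lower parameters on the right as
    \<open>k / w\<close> and \<open>k / v\<close>; the left side has their multiples by
    \<open>q\<close>.\<close>
  have kw: "k / w = y * z * v / k" and kv: "k / v = k * q ^ N"
    and qkw: "q * (k / w) = y * z * (q * v) / k" and qkv: "q * (k / v) = k * q ^ (1 + N)"
    using nz v0 by (simp_all add: w Qv power2_eq_square)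
  let ?P = "qpochs [y, z, w, v] q"
  let ?D = "qpochs [k / y, k / z, k / w, k / v] q"
  let ?D' = "qpochs [q * (k / y), q * (k / z), q * (k / w), q * (k / v)] q"
  let ?F = "(1 - k / y) * (1 - k / z) * (1 - k / w) * (1 - k / v)"
  let ?E = "v * (1 - k / (y * v)) * (1 - k / (z * v)) * (1 - k / (w * v))"
  let ?S = "qpochs [sqrtk, - sqrtk] q"
  define u where "u n = ?P n / ?D n" for n
  \<comment> \<open>\<open>1 - k\<close> comes from \<open>well_poised_ratio\<close>, and
    \<open>?F / ?E\<close> inverts the constant in \<open>coefficient_diff\<close>.\<close>
  define C where "C = ?F / ((1 - k) * ?E)"
  have den: "?S n * ?D' n = qpochs [sqrtk, - sqrtk, q * k / y, q * k / z,
      y * z * q powi (1 - int N) / k, k * q ^ (1 + N)] q n" for n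
    unfolding qkw qkv qv by (simp add: mult_ac)
  have den_right: "qpochs [k / y, k / z, k * q ^ N, y * z * q powi (- int N) / k] q n = ?D n" for n
    unfolding kw kv v_def[symmetric] by (simp add: mult_ac)
  have S: "?S n \<noteq> 0" and D': "?D' n \<noteq> 0" if "n \<le> N" for n
    using assms(8)[OF that] unfolding den[symmetric] by (auto simp del: qpochs_Cons)
  have D: "?D n \<noteq> 0" if "n \<le> N" for n
    using assms(9)[OF that] unfolding den_right .
  have shift: "?D (Suc n) = ?F * ?D' n" for n
    by (simp add: qpoch_Suc_shift mult_ac)
  \<comment> \<open>\<open>?F\<close> is the denominator at index 1, which lies in the range of the
    hypothesis because \<open>N > 0\<close>.\<close>
  have F0: "?F \<noteq> 0"
    using D[of "Suc 0"] assms(1) unfolding shift by (auto simp del: qpochs_Cons)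
  have k1: "1 - k \<noteq> 0"
    using assms(10) by auto
  \<comment> \<open>Here \<open>k / (w * v)\<close> is the reciprocal of \<open>k / (y * z)\<close>,
    and \<open>1 - 1/x = - (1/x) * (1 - x)\<close>. The same inversion in \<open>kw'\<close> gives
    \<open>?F\<close> and \<open>?E\<close> the common factor \<open>- (v * y * z / k)\<close>,
    which cancels in \<open>C\<close>.\<close>
  have kwv: "1 - k / (w * v) = - (y * z / k) * (1 - k / (y * z))"
    using nz v0 by (simp add: w field_simps power2_eq_square)
  have E: "?E = - (v * y * z / k) * ((1 - k / (y * z)) * (1 - k * q ^ N / y) * (1 - k * q ^ N / z))"
    unfolding kwv Qv by (simp add: mult_ac)
  have E0: "?E \<noteq> 0"
    using assms(10) nz v0 unfolding E by auto
  have kw': "1 - k / w = - (v * y * z / k) * (1 - k * q ^ N / (y * z))"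
    using nz v0 by (simp add: w Qv field_simps power2_eq_square)
  have C: "(1 - k / y) * (1 - k / z) * (1 - k * q ^ N) * (1 - k * q ^ N / (y * z))
         / ((1 - k) * (1 - k / (y * z)) * (1 - k * q ^ N / y) * (1 - k * q ^ N / z)) = C"
  proof -
    have "C = (- (v * y * z / k) * ((1 - k / y) * (1 - k / z) * (1 - k * q ^ N) * (1 - k * q ^ N / (y * z))))
        / (- (v * y * z / k) * ((1 - k) * (1 - k / (y * z)) * (1 - k * q ^ N / y) * (1 - k * q ^ N / z)))"
      unfolding C_def E kw' kv by (simp only: mult_ac)
    also have "\<dots> = (1 - k / y) * (1 - k / z) * (1 - k * q ^ N) * (1 - k * q ^ N / (y * z))
         / ((1 - k) * (1 - k / (y * z)) * (1 - k * q ^ N / y) * (1 - k * q ^ N / z))"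
      using nz v0 by (subst mult_divide_mult_cancel_left) auto
    finally show ?thesis ..
  qed
  have left: "qpochs [q * sqrtk, - q * sqrtk, y, z, w, v] q n / (?S n * ?D' n) * q ^ n
      = C * (u n - u (Suc n))" if "n \<le> N" for n
  proof -
    have "qpochs [q * sqrtk, - q * sqrtk, y, z, w, v] q n / (?S n * ?D' n) * q ^ n
        = (qpoch (q * sqrtk) q n * qpoch (- (q * sqrtk)) q n / (qpoch sqrtk q n * qpoch (- sqrtk) q n))
          * (?P n / ?D' n * q ^ n)"
      by (simp add: mult_ac)
    also have "\<dots> = (1 - k * (q ^ n)\<^sup>2) / (1 - k) * (?P n / ?D' n * q ^ n)"
      using S[OF that] k1 by (subst well_poised_ratio[OF assms(6)]) auto
    also have "\<dots> = C * (?E / ?F * ((1 - k * (q ^ n)\<^sup>2) * ?P n / ?D' n * q ^ n))"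
    proof -
      have "A / m * (B / e * t) = F / (m * E') * (E' / F * (A * B / e * t))"
        if "F \<noteq> 0" "E' \<noteq> 0" for A m B e t F E' :: complex
        using that by simp
      from this[OF F0 E0] show ?thesis
        unfolding C_def .
    qed
    \<comment> \<open>For \<open>n = N\<close> this needs the denominator at \<open>Suc N\<close>,
      beyond the range of \<open>D\<close>; it is nonzero as the product of \<open>?F\<close> and
      \<open>?D' N\<close>.\<close>
    also have "?E / ?F * ((1 - k * (q ^ n)\<^sup>2) * ?P n / ?D' n * q ^ n) = u n - u (Suc n)"
      unfolding u_def using F0 D'[OF that]
      by (intro coefficient_diff[symmetric] nz balanced) (simp only: shift mult_eq_0_iff simp_thms)
    finally show ?thesis .
  qed
  have "u (Suc N) = 0"
    using qpoch_power_int_eq_0[OF nz(1), of N "Suc N"] by (simp add: u_def v_def)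
  then have "(\<Sum>n\<le>N. C * (u n - u (Suc n)) * \<beta> n) = C * (\<Sum>n\<le>N. u n * \<alpha> n)"
    using sum_by_parts[of u \<alpha> N] by (simp add: assms(7) mult.assoc flip: sum_distrib_left)
  moreover have "(\<Sum>n\<le>N. qpochs [q * sqrtk, - q * sqrtk, y, z, w, v] q n / (?S n * ?D' n) * q ^ n * \<beta> n)
      = (\<Sum>n\<le>N. C * (u n - u (Suc n)) * \<beta> n)"
    by (intro sum.cong refl, subst left) simp_all
  ultimately show ?thesis
    unfolding den[symmetric] den_right C u_def by (simp only: v_def w_def)
qed

end
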